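(* Let $q$ be odd and let $h_1$ be a polynomial over $GF(q)$. Put $g(x,y)=h_1(x)$. If the set of lines $$\mathcal S_g = \langle (0,0,0,1),(0,0,1,0)\rangle \cup \{ \langle (0,1,x,y), (1,0,-y,g(x,y)) \rangle \ | \ x,y \in GF(q) \}$$ is a (symplectic) spread of $PG(3,q)$, then $\mathcal S_g$ is either a regular spread or a Kantor spread.
   Context: $PG(3,q)$ is the projective space of dimension 3 over $GF(q)$; $\langle u,v\rangle$ denotes the line through points $u,v$. A spread is a set of lines partitioning the points of $PG(3,q)$; it is symplectic if its lines are totally isotropic for a fixed non-degenerate alternating form, here $((x_0,x_1,x_2,x_3),(y_0,y_1,y_2,y_3))=x_0y_3-x_3y_0-x_1y_2+y_1x_2$ (the lines of $\mathcal S_g$ are automatically totally isotropic). A regular spread is one that contains, along with any three of its lines, all lines of the regulus they determine; for $q$ odd it is (up to equivalence) $\mathcal S_g$ with $g(x,y)=-nx$, $n$ a non-square in $GF(q)$. A Kantor spread is a spread equivalent (under a collineation of $PG(3,q)$) to $\mathcal S_g$ with $g(x,y)=-nx^{\alpha}$, where $n$ is a non-square in $GF(q)$ and $\alpha$ is a power of the characteristic of $GF(q)$. *)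

theory Defs
  imports
    "HOL-Analysis.Analysis"
    "HOL-Computational_Algebra.Computational_Algebra"
begin

text \<open>
  \<open>PG(3,q)\<close> over the finite field \<^typ>\<open>'a\<close> with \<open>q = CARD('a)\<close>. A point is a one-dimensional
  subspace of the four-dimensional vector space; a line is the set of points contained in some
  two-dimensional subspace. The coordinates $(x_0,x_1,x_2,x_3)$ are the components \<open>1, 2, 3, 4\<close>
  of a vector.
\<close>

definition pg_points :: "('a::field ^ 4) set set" where
  "pg_points = {P. vec.subspace P \<and> vec.dim P = 1}"

definition points_in :: "('a::field ^ 4) set \<Rightarrow> ('a ^ 4) set set" where
  "points_in W = {P \<in> pg_points. P \<subseteq> W}"

definition pg_lines :: "('a::field ^ 4) set set set" where
  "pg_lines = {points_in W | W. vec.subspace W \<and> vec.dim W = 2}"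

text \<open>The vectors are homogeneous coordinates of the two points.\<close>

definition line_through :: "'a::field ^ 4 \<Rightarrow> 'a ^ 4 \<Rightarrow> ('a ^ 4) set set" where
  "line_through u v = points_in (vec.span {u, v})"

definition pg_collineation :: "(('a::field ^ 4) set \<Rightarrow> ('a ^ 4) set) \<Rightarrow> bool" where
  "pg_collineation f \<longleftrightarrow>
     bij_betw f pg_points pg_points \<and>
     (\<forall>l \<subseteq> pg_points. f ` l \<in> pg_lines \<longleftrightarrow> l \<in> pg_lines)"

definition pg_spread :: "('a::field ^ 4) set set set \<Rightarrow> bool" where
  "pg_spread S \<longleftrightarrow> S \<subseteq> pg_lines \<and> partition_on pg_points S"

text \<open>
  The regulus determined by three pairwise skew lines consists of the lines that meet every
  transversal of the three.
\<close>

definition transversals ::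
  "('a::field ^ 4) set set \<Rightarrow> ('a ^ 4) set set \<Rightarrow> ('a ^ 4) set set \<Rightarrow> ('a ^ 4) set set set" where
  "transversals a b c = {t \<in> pg_lines. t \<inter> a \<noteq> {} \<and> t \<inter> b \<noteq> {} \<and> t \<inter> c \<noteq> {}}"

definition regulus ::
  "('a::field ^ 4) set set \<Rightarrow> ('a ^ 4) set set \<Rightarrow> ('a ^ 4) set set \<Rightarrow> ('a ^ 4) set set set" where
  "regulus a b c = {m \<in> pg_lines. \<forall>t \<in> transversals a b c. t \<inter> m \<noteq> {}}"

definition regular_spread :: "('a::field ^ 4) set set set \<Rightarrow> bool" where
  "regular_spread S \<longleftrightarrow>
     pg_spread S \<and>
     (\<forall>a \<in> S. \<forall>b \<in> S. \<forall>c \<in> S. a \<noteq> b \<and> a \<noteq> c \<and> b \<noteq> c \<longrightarrow> regulus a b c \<subseteq> S)"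

definition S_lines :: "('a::field \<Rightarrow> 'a \<Rightarrow> 'a) \<Rightarrow> ('a ^ 4) set set set" where
  "S_lines g =
     {line_through (vector [0, 0, 0, 1]) (vector [0, 0, 1, 0])} \<union>
     {line_through (vector [0, 1, x, y]) (vector [1, 0, - y, g x y]) | x y. True}"

text \<open>The exponent $\alpha = p^k$ may be 1 (\<open>k = 0\<close>).\<close>

definition kantor_spread :: "('a::finite_field ^ 4) set set set \<Rightarrow> bool" where
  "kantor_spread S \<longleftrightarrow>
     pg_spread S \<and>
     (\<exists>f n k. pg_collineation f \<and> \<not> is_square n \<and>
        (\<lambda>l. f ` l) ` S_lines (\<lambda>x y. - n * x ^ (CHAR('a) ^ k)) = S)"

definition symp_form :: "'a::field ^ 4 \<Rightarrow> 'a ^ 4 \<Rightarrow> 'a" where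
  "symp_form x y = x $ 1 * y $ 4 - x $ 4 * y $ 1 - x $ 2 * y $ 3 + y $ 2 * x $ 3"

definition totally_isotropic :: "('a::field ^ 4) set set \<Rightarrow> bool" where
  "totally_isotropic l \<longleftrightarrow> (\<forall>P \<in> l. \<forall>Q \<in> l. \<forall>u \<in> P. \<forall>v \<in> Q. symp_form u v = 0)"

definition symplectic_spread :: "('a::field ^ 4) set set set \<Rightarrow> bool" where
  "symplectic_spread S \<longleftrightarrow> pg_spread S \<and> (\<forall>l \<in> S. totally_isotropic l)"

lemma vector_4 [simp]:
  "(vector [w, x, y, z] :: 'a::zero ^ 4) $ 1 = w"
  "(vector [w, x, y, z] :: 'a::zero ^ 4) $ 2 = x"
  "(vector [w, x, y, z] :: 'a::zero ^ 4) $ 3 = y"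
  "(vector [w, x, y, z] :: 'a::zero ^ 4) $ 4 = z"
  unfolding vector_def by simp_all

lemma totally_isotropic_line_through:
  assumes "symp_form u v = 0"
  shows "totally_isotropic (line_through u v)"
proof -
  have "symp_form a b = 0" if ab: "a \<in> vec.span {u, v}" "b \<in> vec.span {u, v}" for a b
  proof -
    obtain r s where a: "a = r *s u + s *s v"
      using ab(1) by (auto simp: vec.span_insert vec.span_singleton algebra_simps)
    obtain r' s' where b: "b = r' *s u + s' *s v"
      using ab(2) by (auto simp: vec.span_insert vec.span_singleton algebra_simps)
    have "symp_form a b = (r * s' - s * r') * symp_form u v"
      by (simp add: a b symp_form_def algebra_simps)
    then show ?thesis
      using assms by simp
  qed
  then show ?thesis
    by (auto simp: totally_isotropic_def line_through_def points_in_def)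
qed

text \<open>For the sets of lines considered here, being symplectic is no extra condition on a spread.\<close>

lemma symplectic_spread_S_lines_iff: "symplectic_spread (S_lines g) \<longleftrightarrow> pg_spread (S_lines g)"
proof -
  have "totally_isotropic l" if "l \<in> S_lines g" for l
    using that unfolding S_lines_def
    by (auto intro!: totally_isotropic_line_through simp: symp_form_def)
  then show ?thesis
    by (auto simp: symplectic_spread_def)
qed

end

theory Submission
  imports Defs "HOL-Number_Theory.Cong"
begin

text \<open>
  Lines of \<open>S_lines g\<close> are pairwise skew iff \<open>- (x - x') * (h x - h x')\<close> is a non-square for all
  \<open>x \<noteq> x'\<close>. By Euler's criterion this says \<open>(h x - h y) ^ m = \<epsilon> * (x - y) ^ m\<close> for all \<open>x\<close>, \<open>y\<close>, where
  \<open>m = (q - 1) / 2\<close>, and a theorem of Carlitz forces \<open>h x = a * x ^ (p ^ k) + c\<close>. A shear removes \<open>c\<close>.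
  Since \<open>k = 0\<close> is allowed for Kantor spreads, the regular case is included.

  Carlitz's theorem: expanding \<open>(z - h x) ^ m\<close> shows that \<open>h ^ k\<close> has reduced degree at most \<open>m\<close>
  whenever \<open>p\<close> does not divide \<open>m choose k\<close>, in particular when the base \<open>p\<close> digits of \<open>k\<close> are at
  most \<open>(p - 1) / 2\<close>. This bounds the sum of the reduced degrees of the conjugates \<open>h ^ (p ^ i)\<close> by
  \<open>1 + p + \<dots> + p ^ (e - 1)\<close>. The exponents of the conjugates are the cyclic digit shifts of those
  of \<open>h\<close>, so each non-constant exponent of \<open>h\<close> has digit sum one.
\<close>

subsection \<open>Finite fields\<close>

lemma finite_field_card_gt_1: "CARD('a::finite_field) > 1"
  using card_mono[of UNIV "{0, 1 :: 'a}"] by simp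

text \<open>Additive subgroups of \<open>p\<close>-power order grow one generator at a time:
  adjoining \<open>x\<close> outside \<open>H\<close> yields \<open>p\<close> disjoint translates of
  \<open>H\<close>. A largest such subgroup is therefore the whole field.\<close>

lemma finite_field_card_prime_power:
  "\<exists>e>0. CARD('a::finite_field) = CHAR('a) ^ e"
proof -
  let ?p = "CHAR('a)"
  define grp where "grp H \<longleftrightarrow> 0 \<in> H \<and> (\<forall>u\<in>H. \<forall>v\<in>H. u + v \<in> H)" for H :: "'a set"
  have grp_mult: "of_nat n * u \<in> H" if "grp H" "u \<in> H" for H n and u :: 'a
    using that by (induction n) (auto simp: grp_def distrib_right)
  have extend: "\<exists>H'. grp H' \<and> card H' = ?p * card H" if H: "grp H" and x: "x \<notin> H" for H x
  proof -
    let ?f = "\<lambda>(u, i). u + of_nat i * x"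
    let ?H' = "?f ` (H \<times> {..<?p})"
    \<comment> \<open>In characteristic \<open>p\<close>, \<open>- u\<close> is a sum of
      \<open>p - 1\<close> copies of \<open>u\<close>.\<close>
    have minus: "- u \<in> H" if "u \<in> H" for u
    proof -
      have "of_nat (?p - 1) * u = - u"
        by (subst of_nat_diff) (auto simp: left_diff_distrib Suc_le_eq)
      then show ?thesis
        using grp_mult[OF H that, of "?p - 1"] by simp
    qed
    \<comment> \<open>\<open>n\<close> is invertible modulo \<open>p\<close>, so \<open>x\<close> is
      itself a multiple of \<open>of_nat n * x\<close> and would land in \<open>H\<close>.\<close>
    have no_mult: "of_nat n * x \<notin> H" if "0 < n" "n < ?p" for n
    proof
      assume nx: "of_nat n * x \<in> H"
      have "coprime n ?p"
        using that by (metis CHAR_prime coprime_commute nat_dvd_not_less prime_imp_coprime_nat)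
      then obtain n' where "[n * n' = 1] (mod ?p)"
        using cong_solve_coprime_nat by (metis One_nat_def)
      then have "(of_nat (n * n') :: 'a) = of_nat 1"
        by (simp only: of_nat_eq_iff_cong_CHAR)
      then have "(of_nat n' * of_nat n :: 'a) = 1"
        by (simp add: mult.commute)
      then have "of_nat n' * (of_nat n * x) = x"
        by (simp only: mult_1_left flip: mult.assoc)
      moreover have "of_nat n' * (of_nat n * x) \<in> H"
        by (rule grp_mult[OF H nx])
      ultimately show False
        using x by (simp only:)
    qed
    have aux: "i = j" if "u \<in> H" "v \<in> H" "i < ?p" "j < ?p" "i \<le> j"
      "u + of_nat i * x = v + of_nat j * x" for u v i j
    proof (rule ccontr)
      assume "i \<noteq> j"
      then have ij: "0 < j - i" "j - i < ?p"
        using that(4,5) by linarith+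
      have "of_nat (j - i) * x = u + - v"
        using that by (simp add: of_nat_diff algebra_simps)
      also have "\<dots> \<in> H"
        using H minus that unfolding grp_def by blast
      finally show False
        using no_mult[of "j - i"] ij by blast
    qed
    have "inj_on ?f (H \<times> {..<?p})"
    proof (rule inj_onI)
      fix a b assume ab: "a \<in> H \<times> {..<?p}" "b \<in> H \<times> {..<?p}" "?f a = ?f b"
      obtain u i v j where eq: "a = (u, i)" "b = (v, j)"
        by (cases a; cases b)
      with ab have *: "u \<in> H" "v \<in> H" "i \<in> {..<?p}" "j \<in> {..<?p}"
        "u + of_nat i * x = v + of_nat j * x"
        by auto
      have "i = j"
        using aux[OF *(1,2) _ _ _ *(5)] aux[OF *(2,1) _ _ _ *(5)[symmetric]] *(3,4)
        by (metis lessThan_iff nle_le)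
      then show "a = b"
        using * eq by simp
    qed
    then have "card ?H' = ?p * card H"
      by (simp add: card_image card_cartesian_product)
    moreover have "grp ?H'"
    proof -
      have mem: "w + of_nat n * x \<in> ?H'" if "w \<in> H" for w n
      proof -
        have "(of_nat n :: 'a) = of_nat (n mod ?p)"
          by (simp add: of_nat_eq_iff_cong_CHAR cong_def)
        moreover have "n mod ?p < ?p"
          by simp
        ultimately show ?thesis
          using that by (intro image_eqI[of _ _ "(w, n mod ?p)"]) auto
      qed
      have "0 \<in> ?H'"
        using mem[of 0 0] H by (simp add: grp_def)
      moreover have "a + b \<in> ?H'" if ab: "a \<in> ?H'" "b \<in> ?H'" for a b
      proof -
        obtain u i where u: "u \<in> H" "a = u + of_nat i * x"
          using ab(1) by auto
        obtain v j where v: "v \<in> H" "b = v + of_nat j * x"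
          using ab(2) by auto
        have "a + b = (u + v) + of_nat (i + j) * x"
          by (simp add: u v algebra_simps)
        moreover have "u + v \<in> H"
          using H u v by (simp add: grp_def)
        ultimately show ?thesis
          by (simp only: mem)
      qed
      ultimately show ?thesis
        by (simp add: grp_def)
    qed
    ultimately show ?thesis
      by blast
  qed
  let ?P = "\<lambda>H. grp H \<and> (\<exists>e. card H = ?p ^ e)"
  have "?P {0}"
    by (auto simp: grp_def intro: exI[of _ 0])
  moreover have "\<forall>H. ?P H \<longrightarrow> card H < Suc CARD('a)"
    by (simp add: card_mono less_Suc_eq_le)
  ultimately obtain H where H: "?P H" and max: "\<And>H'. ?P H' \<Longrightarrow> card H' \<le> card H"
    using ex_has_greatest_nat[of ?P "{0}" card "Suc CARD('a)"] by blast
  have "H = UNIV"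
  proof (rule ccontr)
    assume "H \<noteq> UNIV"
    then obtain x where "x \<notin> H"
      by blast
    with H extend obtain H' where H': "grp H'" "card H' = ?p * card H"
      by blast
    moreover obtain e where e: "card H = ?p ^ e"
      using H by blast
    ultimately have "card H' \<le> card H"
      by (intro max) (auto intro!: exI[of _ "Suc e"])
    moreover have "?p > 1" "card H > 0"
      using CHAR_prime[where 'a = 'a] e by (auto simp del: CHAR_prime dest: prime_gt_1_nat)
    ultimately show False
      using H' by simp
  qed
  with H obtain e where e: "CARD('a) = ?p ^ e"
    by blast
  then have "e > 0"
    using finite_field_card_gt_1[where 'a='a] by (cases e) auto
  with e show ?thesis
    by blast
qed

section \<open>Powers, power sums and reduced polynomials\<close>

lemma finite_field_power_card_minus_1:
  fixes x :: "'a::finite_field"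
  assumes "x \<noteq> 0"
  shows "x ^ (CARD('a) - 1) = 1"
proof -
  have "x * x ^ (CARD('a) - 1) = x"
    using finite_field_power_card_eq_same[of x] finite_field_card_gt_1[where 'a='a]
    by (simp flip: power_Suc)
  then show ?thesis
    using assms by simp
qed

lemma finite_field_power_cong:
  fixes x :: "'a::finite_field"
  assumes "[m = n] (mod (CARD('a) - 1))" "m > 0" "n > 0"
  shows "x ^ m = x ^ n"
proof (cases "x = 0")
  case False
  have red: "x ^ k = x ^ (k mod (CARD('a) - 1))" for k
  proof -
    have "x ^ k = x ^ ((CARD('a) - 1) * (k div (CARD('a) - 1)) + k mod (CARD('a) - 1))"
      by simp
    also have "\<dots> = x ^ (k mod (CARD('a) - 1))"
      by (simp only: power_add power_mult finite_field_power_card_minus_1[OF False]) simp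
    finally show ?thesis .
  qed
  show ?thesis
    using assms(1) red[of m] red[of n] by (simp add: cong_def)
qed (use assms in \<open>simp add: power_0_left\<close>)

text \<open>Substituting \<open>c * x\<close> for \<open>x\<close> multiplies the sum by
  \<open>c ^ n\<close>, which kills it once some \<open>c \<noteq> 0\<close> has
  \<open>c ^ n \<noteq> 1\<close>. If \<open>q - 1\<close> divides \<open>n > 0\<close>, the nonzero
  \<open>x\<close> contribute \<open>q - 1 = - 1\<close>; for \<open>n = 0\<close> the convention
  \<open>0 ^ 0 = 1\<close> gives \<open>q = 0\<close>.\<close>

lemma sum_powers_finite_field:
  "(\<Sum>x\<in>UNIV. x ^ n) = (if n > 0 \<and> (CARD('a) - 1) dvd n then - 1 else (0::'a::finite_field))"
proof -
  let ?Q = "CARD('a) - 1"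
  have card0: "of_nat CARD('a) = (0 :: 'a)"
  proof -
    obtain e where "e > 0" "CARD('a) = CHAR('a) ^ e"
      using finite_field_card_prime_power by blast
    then show ?thesis
      by (auto simp: power_0_left)
  qed
  have Q: "?Q > 0"
    using finite_field_card_gt_1[where 'a='a] by simp
  consider "n = 0" | "n > 0" "?Q dvd n" | "\<not> ?Q dvd n"
    by auto
  then show ?thesis
  proof cases
    case 1
    then show ?thesis
      using card0 by simp
  next
    case 2
    then obtain k where k: "n = ?Q * k"
      by blast
    have "(\<Sum>x\<in>UNIV. x ^ n) = (\<Sum>x\<in>UNIV - {0::'a}. x ^ n)"
      using 2 by (intro sum.mono_neutral_right) (auto simp: power_0_left)
    also have "\<dots> = (\<Sum>x\<in>UNIV - {0::'a}. 1)"
    proof (intro sum.cong refl)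
      fix x :: 'a assume "x \<in> UNIV - {0}"
      then have "x ^ ?Q = 1"
        by (intro finite_field_power_card_minus_1) auto
      then show "x ^ n = 1"
        unfolding k power_mult by (simp only: power_one)
    qed
    also have "\<dots> = of_nat CARD('a) - 1"
      using Q by (simp add: card_Diff_singleton of_nat_diff)
    finally show ?thesis
      using 2 card0 by simp
  next
    case 3
    let ?r = "n mod ?Q"
    have r: "0 < ?r" "?r < ?Q"
      using 3 Q by (auto simp: mod_greater_zero_iff_not_dvd)
    \<comment> \<open>Otherwise all \<open>q - 1\<close> nonzero elements are roots of
      \<open>x ^ r - 1\<close>, whose degree \<open>r\<close> is below \<open>q - 1\<close>.\<close>
    have "\<exists>c::'a. c \<noteq> 0 \<and> c ^ n \<noteq> 1"
    proof (rule ccontr)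
      assume *: "\<not> ?thesis"
      have root: "c ^ ?r = 1" if "c \<noteq> 0" for c :: 'a
      proof -
        have "c ^ n = c ^ ?r"
          using r 3 by (intro finite_field_power_cong) (auto simp: cong_def intro!: Nat.gr0I)
        then show ?thesis
          using * that by auto
      qed
      let ?P = "monom 1 ?r - 1 :: 'a poly"
      have "poly.coeff ?P ?r = 1"
        using r by simp
      then have P: "?P \<noteq> 0"
        by (metis coeff_0 zero_neq_one)
      have deg: "degree ?P \<le> ?r"
        by (intro degree_diff_le) (auto simp: degree_monom_eq)
      have "card (UNIV - {0::'a}) \<le> card {x. poly ?P x = 0}"
        using root by (intro card_mono) (auto simp: poly_monom)
      also have "\<dots> \<le> degree ?P"
        using P by (rule card_poly_roots_bound)
      finally show False
        using deg r by (simp add: card_Diff_singleton)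
    qed
    then obtain c :: 'a where c: "c \<noteq> 0" "c ^ n \<noteq> 1"
      by blast
    have "(\<Sum>x\<in>UNIV. x ^ n) = (\<Sum>x\<in>UNIV. (c * x) ^ n)"
      by (rule sum.reindex_bij_witness[of _ "\<lambda>x. c * x" "\<lambda>x. x / c"]) (use c in auto)
    also have "\<dots> = c ^ n * (\<Sum>x\<in>UNIV. x ^ n)"
      by (simp add: power_mult_distrib sum_distrib_left)
    finally have "(\<Sum>x\<in>UNIV. x ^ n) = (0::'a)"
      using c by simp
    then show ?thesis
      using 3 by simp
  qed
qed

text \<open>Of the exponents \<open>j + (q - 1 - s)\<close>, all below \<open>2 * (q - 1)\<close>,
  only \<open>j = s\<close> gives a positive multiple of \<open>q - 1\<close>. For
  \<open>s = 0\<close> the terms \<open>j = 0\<close> and \<open>j = q - 1\<close> would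
  mix.\<close>

lemma sum_power_times_poly:
  fixes P :: "'a::finite_field poly"
  assumes "degree P \<le> CARD('a) - 1" "0 < s" "s \<le> CARD('a) - 1"
  shows "(\<Sum>x\<in>UNIV. x ^ (CARD('a) - 1 - s) * poly P x) = - poly.coeff P s"
proof -
  let ?Q = "CARD('a) - 1"
  have "(\<Sum>x\<in>UNIV. x ^ (?Q - s) * poly P x)
      = (\<Sum>x\<in>UNIV. \<Sum>j\<le>degree P. poly.coeff P j * x ^ (j + (?Q - s)))"
    by (simp add: poly_altdef sum_distrib_left power_add mult_ac)
  also have "\<dots> = (\<Sum>j\<le>degree P. poly.coeff P j * (\<Sum>x\<in>UNIV. x ^ (j + (?Q - s))))"
    by (subst sum.swap) (simp add: sum_distrib_left)
  also have "\<dots> = (\<Sum>j\<le>degree P. if j = s then - poly.coeff P j else 0)"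
  proof (intro sum.cong refl)
    fix j assume "j \<in> {..degree P}"
    then have j: "j + (?Q - s) < 2 * ?Q"
      using assms by auto
    have "0 < j + (?Q - s) \<and> ?Q dvd j + (?Q - s) \<longleftrightarrow> j = s"
    proof
      assume *: "0 < j + (?Q - s) \<and> ?Q dvd j + (?Q - s)"
      then obtain k where k: "j + (?Q - s) = ?Q * k"
        by blast
      have "k < 2"
        using j unfolding k by (metis mult.commute mult_less_cancel1)
      moreover have "k \<noteq> 0"
        using * k by (intro notI) simp
      ultimately have "k = 1"
        by simp
      then show "j = s"
        using k assms by simp
    qed (use assms in auto)
    then show "poly.coeff P j * (\<Sum>x\<in>UNIV. x ^ (j + (?Q - s))) = (if j = s then - poly.coeff P j else 0)"
      by (simp only: sum_powers_finite_field) auto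
  qed
  also have "\<dots> = - poly.coeff P s"
    by (auto simp: coeff_eq_0)
  finally show ?thesis .
qed

text \<open>Lagrange basis: \<open>1 - (x - a) ^ (q - 1)\<close> is 1 at \<open>a\<close> and 0
  elsewhere.\<close>

lemma finite_field_interpolation:
  fixes \<phi> :: "'a::finite_field \<Rightarrow> 'a"
  shows "\<exists>P. degree P \<le> CARD('a) - 1 \<and> (\<forall>x. poly P x = \<phi> x)"
proof -
  let ?L = "\<lambda>a. smult (\<phi> a) (1 - [:- a, 1:] ^ (CARD('a) - 1))"
  have "degree (?L a) \<le> CARD('a) - 1" for a
    by (intro order.trans[OF degree_smult_le] degree_diff_le)
       (auto intro: order.trans[OF degree_power_le])
  then have "degree (\<Sum>a\<in>UNIV. ?L a) \<le> CARD('a) - 1"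
    by (intro degree_sum_le) auto
  moreover have "poly (\<Sum>a\<in>UNIV. ?L a) x = \<phi> x" for x
  proof -
    have "poly (?L a) x = (if a = x then \<phi> a else 0)" for a
      using finite_field_card_gt_1[where 'a='a] finite_field_power_card_minus_1[of "x - a"]
      by (auto simp: poly_power power_0_left algebra_simps)
    then show ?thesis
      by (simp add: poly_sum)
  qed
  ultimately show ?thesis
    by blast
qed

text \<open>With \<open>m = (q - 1) / 2\<close>, the nonzero squares supply \<open>m\<close> roots
  of \<open>x ^ m - 1\<close>. A non-square root would exceed the degree, and \<open>z ^ m\<close>
  can only be 1 or -1.\<close>

lemma not_square_power_half_card:
  fixes z :: "'a::finite_field"
  assumes "odd CARD('a)" "\<not> is_square z"
  shows "z ^ ((CARD('a) - 1) div 2) = - 1"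
proof -
  let ?m = "(CARD('a) - 1) div 2"
  have m: "2 * ?m = CARD('a) - 1" "?m > 0"
    using assms(1) finite_field_card_gt_1[where 'a='a] by (auto elim!: oddE)
  have z: "z \<noteq> 0"
    using assms(2) by auto
  have "(z ^ ?m)\<^sup>2 = 1"
    using finite_field_power_card_minus_1[OF z] m(1) by (metis power_mult mult.commute)
  moreover have "z ^ ?m \<noteq> 1"
  proof
    assume one: "z ^ ?m = 1"
    let ?S = "(\<lambda>x. x\<^sup>2) ` (UNIV - {0::'a})"
    let ?P = "monom 1 ?m - 1 :: 'a poly"
    \<comment> \<open>Squaring is at most two-to-one, so there are at least \<open>m\<close> nonzero
      squares.\<close>
    have "card (UNIV - {0::'a}) \<le> 2 * card ?S"
    proof -
      have "UNIV - {0::'a} = (\<Union>s\<in>?S. {x. x\<^sup>2 = s})"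
        by auto
      also have "card \<dots> \<le> (\<Sum>s\<in>?S. card {x::'a. x\<^sup>2 = s})"
        by (intro card_UN_le) auto
      also have "\<dots> \<le> (\<Sum>s\<in>?S. 2)"
      proof (rule sum_mono)
        fix s assume "s \<in> ?S"
        then obtain y where "s = y\<^sup>2"
          by blast
        then have "{x. x\<^sup>2 = s} \<subseteq> {y, - y}"
          by (auto simp: power2_eq_iff)
        then have "card {x. x\<^sup>2 = s} \<le> card {y, - y}"
          by (intro card_mono) auto
        also have "\<dots> \<le> 2"
          by (simp add: card_insert_if)
        finally show "card {x. x\<^sup>2 = s} \<le> 2" .
      qed
      finally show ?thesis
        by (simp add: mult.commute)
    qed
    then have "?m \<le> card ?S"
      using m by (simp add: card_Diff_singleton)
    also have "card ?S < card (insert z ?S)"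
      using assms(2) by (subst card_insert_disjoint) (auto simp: is_nth_power_def)
    also have "\<dots> \<le> card {x. poly ?P x = 0}"
      using one finite_field_power_card_minus_1[where 'a='a] m
      by (intro card_mono) (auto simp: poly_monom simp flip: power_mult)
    also have "\<dots> \<le> degree ?P"
    proof (rule card_poly_roots_bound)
      have "poly.coeff ?P ?m = 1"
        using m by simp
      then show "?P \<noteq> 0"
        by (metis coeff_0 zero_neq_one)
    qed
    also have "\<dots> \<le> ?m"
      by (intro degree_diff_le) (auto simp: degree_monom_eq)
    finally show False
      by simp
  qed
  ultimately show ?thesis
    by (simp add: power2_eq_1_iff)
qed

subsection \<open>Base-\<open>p\<close> digits\<close>

text \<open>Legendre's formula as a recursion: dividing the multiples of \<open>p\<close> up to
  \<open>n\<close> by \<open>p\<close> leaves the numbers from 1 to \<open>n div p\<close>.\<close>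

lemma multiplicity_fact:
  assumes "prime (p::nat)"
  shows "multiplicity p (fact n :: nat) = n div p + multiplicity p (fact (n div p) :: nat)"
proof (induction n)
  case (Suc n)
  have p: "p > 1"
    using assms by (rule prime_gt_1_nat)
  have "multiplicity p (fact (Suc n) :: nat) = multiplicity p (Suc n) + multiplicity p (fact n :: nat)"
    using assms by (simp add: prime_elem_multiplicity_mult_distrib del: mult_Suc)
  moreover have "multiplicity p (Suc n) + (n div p + multiplicity p (fact (n div p) :: nat))
      = Suc n div p + multiplicity p (fact (Suc n div p) :: nat)"
  proof (cases "p dvd Suc n")
    case True
    then obtain k where k: "Suc n = p * k"
      by blast
    then obtain k' where k': "k = Suc k'"
      by (cases k) auto
    have "Suc n div p = Suc (n div p)"
      using True by (simp add: div_Suc dvd_eq_mod_eq_0)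
    moreover have "Suc n div p = k"
      using k p by simp
    ultimately have "n div p = k'" "Suc n div p = Suc k'"
      using k' by auto
    moreover have "multiplicity p (Suc n) = Suc (multiplicity p (Suc k'))"
      unfolding k k' using p assms
      by (intro multiplicity_times_same) auto
    moreover have "multiplicity p (fact (Suc k') :: nat) = multiplicity p (Suc k') + multiplicity p (fact k' :: nat)"
      using assms by (simp add: prime_elem_multiplicity_mult_distrib del: mult_Suc)
    ultimately show ?thesis
      by simp
  next
    case False
    then show ?thesis
      by (simp add: not_dvd_imp_multiplicity_0 div_Suc dvd_eq_mod_eq_0)
  qed
  ultimately show ?case
    using Suc.IH by simp
qed auto

text \<open>The digit step of Lucas' theorem, as far as it concerns divisibility by \<open>p\<close>.\<close>

lemma not_dvd_binomial_step:
  assumes "prime (p::nat)" "b \<le> a" "a < p" "B \<le> A" "\<not> p dvd (A choose B)"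
  shows "\<not> p dvd ((p * A + a) choose (p * B + b))"
proof -
  have mult_choose: "multiplicity p (fact k :: nat) + multiplicity p (fact (n - k) :: nat)
      + multiplicity p (n choose k) = multiplicity p (fact n :: nat)" if "k \<le> n" for n k
  proof -
    have "multiplicity p (fact n :: nat) = multiplicity p (fact k * fact (n - k) * (n choose k))"
      using binomial_fact_lemma[OF that] by simp
    then show ?thesis
      using assms(1) that by (simp add: prime_elem_multiplicity_mult_distrib)
  qed
  have le: "p * B + b \<le> p * A + a"
    using assms by (simp add: add_mono)
  \<comment> \<open>No borrow occurs because \<open>b \<le> a\<close>, so division by
    \<open>p\<close> strips the last digit in all three factorials, and the quotients in Legendre's
    recursion cancel.\<close>
  have diff: "p * A + a - (p * B + b) = p * (A - B) + (a - b)"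
    using assms by (simp add: diff_mult_distrib2)
  have div_digit: "(p * x + y) div p = x" if "y < p" for x y
    using that by simp
  have div: "(p * A + a) div p = A" "(p * B + b) div p = B" "(p * (A - B) + (a - b)) div p = A - B"
    using assms by (simp_all only: div_digit less_imp_diff_less le_less_trans)
  have "multiplicity p ((p * A + a) choose (p * B + b)) = multiplicity p (A choose B)"
    using mult_choose[OF le] mult_choose[OF assms(4)] assms(4)
      multiplicity_fact[OF assms(1), of "p * A + a"] multiplicity_fact[OF assms(1), of "p * B + b"]
      multiplicity_fact[OF assms(1), of "p * (A - B) + (a - b)"]
    unfolding diff div by linarith
  also have "\<dots> = 0"
    using assms(5) by (rule not_dvd_imp_multiplicity_0)
  finally show ?thesis
    using assms(1) le by (simp add: prime_elem_multiplicity_eq_zero_iff)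
qed

text \<open>In the application \<open>h = (p - 1) / 2\<close> and \<open>p ^ e = q\<close>, so the
  upper number is \<open>(q - 1) / 2\<close>. The Lucas step peels off one digit at a time.\<close>

lemma not_dvd_binomial_digits:
  fixes p :: nat
  assumes "prime p" "h < p" "\<And>i. i < e \<Longrightarrow> c i \<le> h"
  shows "\<not> p dvd ((\<Sum>i<e. h * p ^ i) choose (\<Sum>i<e. c i * p ^ i))"
  using assms(3)
proof (induction e arbitrary: c)
  case (Suc e)
  have shift: "(\<Sum>i<Suc e. d i * p ^ i) = p * (\<Sum>i<e. d (Suc i) * p ^ i) + d 0" for d
    by (subst sum.lessThan_Suc_shift) (simp add: sum_distrib_left mult_ac)
  have "\<not> p dvd ((\<Sum>i<e. h * p ^ i) choose (\<Sum>i<e. c (Suc i) * p ^ i))"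
    using Suc by auto
  moreover have "(\<Sum>i<e. c (Suc i) * p ^ i) \<le> (\<Sum>i<e. h * p ^ i)"
    using Suc.prems by (intro sum_mono mult_right_mono) auto
  ultimately show ?case
    unfolding shift[of c] shift[of "\<lambda>_. h"]
    using Suc.prems assms by (intro not_dvd_binomial_step) auto
qed (use assms in auto)

section \<open>Cyclic shifts of base p digits\<close>

lemma power_diff_1_eq_nat:
  "p > 0 \<Longrightarrow> p ^ e - 1 = (p - 1) * (\<Sum>i<e. p ^ i)" for p :: nat
proof -
  assume "p > 0"
  then have "int (p ^ e - 1) = int ((p - 1) * (\<Sum>i<e. p ^ i))"
    by (simp add: of_nat_diff Suc_le_eq power_diff_1_eq)
  then show ?thesis
    by (simp only: of_nat_eq_iff)
qed

lemma sum_cyclic_window: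
  fixes r :: "nat \<Rightarrow> nat"
  assumes "\<And>i. r (i + e) = r i"
  shows "(\<Sum>i<e. r (s + i)) = (\<Sum>i<e. r i)"
proof (induction s)
  case (Suc s)
  have "(\<Sum>i<e. r (Suc s + i)) + r s = (\<Sum>i<Suc e. r (s + i))"
    by (simp only: sum.lessThan_Suc_shift) simp
  also have "\<dots> = (\<Sum>i<e. r (s + i)) + r s"
    using assms[of s] by simp
  finally show ?case
    using Suc.IH by simp
qed simp

text \<open>
  The residues are the cyclic shifts of the base \<open>p\<close> expansion of \<open>d\<close>, so their sum is the digit sum
  of \<open>d\<close> times \<open>1 + p + \<dots> + p ^ (e - 1)\<close>.
\<close>

definition cyclic_shift :: "nat \<Rightarrow> nat \<Rightarrow> nat \<Rightarrow> nat \<Rightarrow> nat" where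
  "cyclic_shift p e d i = p ^ i * d mod (p ^ e - 1)"

context
  fixes p e d :: nat
  assumes p: "p > 1" and e: "e > 0" and d: "\<not> (p ^ e - 1) dvd d"
begin

private abbreviation (input) "r \<equiv> cyclic_shift p e d"

text \<open>Modulo \<open>p ^ e - 1\<close> the factor \<open>p ^ e\<close> is 1, so multiplication
  by \<open>p\<close> is invertible and returns to the start after \<open>e\<close> steps.\<close>

lemma cyclic_shift_props:
  shows "r i > 0" "r (i + e) = r i" "p * r i mod (p ^ e - 1) = r (Suc i)"
proof -
  define Q where "Q = p ^ e - 1"
  have pe: "p ^ e = Suc Q"
    using p by (simp add: Q_def)
  have "coprime (p ^ e) Q"
    unfolding pe by simp
  then have "coprime Q (p ^ i)"
    using e by (simp add: coprime_commute)
  then have "\<not> Q dvd p ^ i * d"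
    using d by (simp add: coprime_dvd_mult_right_iff Q_def)
  then have "p ^ i * d mod Q \<noteq> 0"
    by (simp add: mod_eq_0_iff_dvd)
  then show "r i > 0"
    by (simp add: cyclic_shift_def Q_def)
  have "p ^ (i + e) * d = p ^ i * d + p ^ i * d * Q"
    unfolding power_add pe by (simp add: algebra_simps)
  then have "p ^ (i + e) * d mod Q = p ^ i * d mod Q"
    by (simp only: mod_mult_self1)
  then show "r (i + e) = r i"
    unfolding cyclic_shift_def Q_def .
  have "p * (p ^ i * d mod Q) mod Q = p ^ Suc i * d mod Q"
    by (simp only: mod_mult_right_eq mult.assoc power_Suc)
  then show "p * r i mod (p ^ e - 1) = r (Suc i)"
    unfolding cyclic_shift_def Q_def .
qed

text \<open>Divide each \<open>p * r i\<close> by \<open>p ^ e - 1\<close> and sum over a period: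
  the remainders \<open>r (Suc i)\<close> again add up to the sum of the \<open>r i\<close>. The
  quotients are the leading base \<open>p\<close> digits of the residues.\<close>

lemma sum_cyclic_shifts_eq:
  shows "(p - 1) * (\<Sum>i<e. r i) = (p ^ e - 1) * (\<Sum>i<e. p * r i div (p ^ e - 1))"
proof -
  let ?Q = "p ^ e - 1"
  have "p * (\<Sum>i<e. r i) = (\<Sum>i<e. ?Q * (p * r i div ?Q) + r (Suc i))"
    unfolding sum_distrib_left
    by (intro sum.cong refl) (metis mult_div_mod_eq cyclic_shift_props(3))
  also have "\<dots> = ?Q * (\<Sum>i<e. p * r i div ?Q) + (\<Sum>i<e. r (1 + i))"
    by (simp add: sum.distrib sum_distrib_left)
  also have "(\<Sum>i<e. r (1 + i)) = (\<Sum>i<e. r i)"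
    by (rule sum_cyclic_window) (rule cyclic_shift_props(2))
  finally show ?thesis
    by (simp add: diff_mult_distrib)
qed

text \<open>Positive residues force a nonzero quotient in \<open>sum_cyclic_shifts_eq\<close>.
  Comparison with \<open>(p - 1) * (\<Sum>i<e. p ^ i) = p ^ e - 1\<close> gives the bound.\<close>

lemma sum_cyclic_shifts_ge:
  "(\<Sum>i<e. p ^ i) \<le> (\<Sum>i<e. r i)"
  (is "?N \<le> ?S")
  and sum_cyclic_shifts_carry: "\<exists>i. p * r i \<ge> p ^ e - 1"
proof -
  let ?Q = "p ^ e - 1"
  let ?U = "\<Sum>i<e. p * r i div ?Q"
  have N: "(p - 1) * ?N = ?Q"
    using p power_diff_1_eq_nat[of p e] by simp
  have "?S > 0"
    using e cyclic_shift_props(1) by (intro sum_pos) auto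
  then have U: "?U > 0"
    using p sum_cyclic_shifts_eq by (metis diff_is_0_eq mult_is_0 neq0_conv not_less)
  then have "(p - 1) * ?N \<le> (p - 1) * ?S"
    using sum_cyclic_shifts_eq N by simp
  then show "?N \<le> ?S"
    using p by simp
  show "\<exists>i. p * r i \<ge> ?Q"
  proof (rule ccontr)
    assume "\<not> ?thesis"
    then have "?U = 0"
      by (simp add: not_le)
    with U show False
      by simp
  qed
qed

text \<open>Let \<open>Q = p ^ e - 1\<close> and \<open>t = r (Suc i)\<close>. At a carry,
  \<open>p * r i\<close> is at least \<open>Q + t\<close>. Going back round the cycle, each residue
  loses at most a factor \<open>p\<close>; the resulting geometric lower bound on the sum, set
  against the assumption, gives \<open>Q + t \<le> p ^ e = Q + 1\<close>.\<close>

lemma cyclic_shift_eq_1: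
  assumes "(\<Sum>i<e. r i) \<le> (\<Sum>i<e. p ^ i)"
  shows "\<exists>i. r i = 1"
proof -
  let ?Q = "p ^ e - 1"
  obtain i where i: "p * r i \<ge> ?Q"
    using sum_cyclic_shifts_carry by auto
  let ?t = "r (Suc i)"
  have start: "p * r i \<ge> ?Q + ?t"
  proof -
    have split: "p * r i = ?Q * (p * r i div ?Q) + ?t"
      by (metis mult_div_mod_eq cyclic_shift_props(3))
    have "?Q > 0"
      using one_less_power[OF p e] by simp
    then have "p * r i div ?Q \<ge> 1"
      using i by (simp add: div_greater_zero_iff Suc_le_eq)
    then have "?Q * 1 \<le> ?Q * (p * r i div ?Q)"
      by (rule mult_le_mono2)
    then show ?thesis
      using split by linarith
  qed
  \<comment> \<open>Adding the period \<open>e\<close> keeps the index \<open>i - k\<close> natural;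
    each step uses \<open>r (Suc j) \<le> p * r j\<close>.\<close>
  have backwards: "p ^ Suc k * r (i + e - k) \<ge> ?Q + ?t" if "k < e" for k
    using that
  proof (induction k)
    case 0
    then show ?case
      using start cyclic_shift_props(2)[of i] by simp
  next
    case (Suc k)
    have "r (i + e - k) \<le> p * r (i + e - Suc k)"
      using cyclic_shift_props(3)[of "i + e - Suc k"] Suc.prems
      by (metis Suc_diff_Suc add.commute less_SucI mod_less_eq_dividend not_less_eq trans_less_add1 Suc_lessD)
    then have "p ^ Suc k * r (i + e - k) \<le> p ^ Suc k * (p * r (i + e - Suc k))"
      by (rule mult_le_mono2)
    also have "\<dots> = p ^ Suc (Suc k) * r (i + e - Suc k)"
      by simp
    finally show ?case
      using Suc by (meson Suc_lessD order.trans)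
  qed
  have "(?Q + ?t) * (\<Sum>k<e. p ^ k) = (\<Sum>k<e. p ^ (e - Suc k) * (?Q + ?t))"
    by (subst sum.nat_diff_reindex[symmetric]) (simp only: mult.commute[of "?Q + ?t"] sum_distrib_right)
  also have "\<dots> \<le> (\<Sum>k<e. p ^ (e - Suc k) * (p ^ Suc k * r (i + e - k)))"
    using backwards by (intro sum_mono mult_le_mono2) auto
  also have "\<dots> = (\<Sum>k<e. p ^ e * r (Suc i + (e - Suc k)))"
  proof (intro sum.cong refl)
    fix k assume "k \<in> {..<e}"
    then have "i + e - k = Suc i + (e - Suc k)" "p ^ (e - Suc k) * p ^ Suc k = p ^ e"
      by (auto simp flip: power_add power_Suc)
    then show "p ^ (e - Suc k) * (p ^ Suc k * r (i + e - k)) = p ^ e * r (Suc i + (e - Suc k))"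
      by (metis mult.assoc)
  qed
  also have "\<dots> = p ^ e * (\<Sum>k<e. r (Suc i + k))"
    by (subst sum.nat_diff_reindex) (simp add: sum_distrib_left)
  also have "(\<Sum>k<e. r (Suc i + k)) = (\<Sum>i<e. r i)"
    by (rule sum_cyclic_window) (rule cyclic_shift_props(2))
  also have "\<dots> \<le> (\<Sum>i<e. p ^ i)"
    using assms by simp
  finally have "(?Q + ?t) * (\<Sum>k<e. p ^ k) \<le> p ^ e * (\<Sum>k<e. p ^ k)"
    by simp
  moreover have "(\<Sum>k<e. p ^ k) > 0"
    using e p by (intro sum_pos) auto
  ultimately have "?Q + ?t \<le> p ^ e"
    by simp
  moreover have "p ^ e \<ge> 1"
    using p by simp
  ultimately have "?t \<le> 1"
    by linarith
  then have "?t = 1"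
    using cyclic_shift_props(1)[of "Suc i"] by linarith
  then show ?thesis
    by blast
qed

end

subsection \<open>Carlitz's theorem\<close>

context
  fixes f :: "'a::finite_field \<Rightarrow> 'a" and \<epsilon> :: 'a and m :: nat
  assumes card: "CARD('a) = 2 * m + 1"
    and \<epsilon>: "\<epsilon> \<noteq> 0"
    and f: "\<And>x y. (f x - f y) ^ m = \<epsilon> * (x - y) ^ m"
begin

lemma m_pos: "m > 0"
  using card finite_field_card_gt_1[where 'a='a] by simp

lemma card_minus_1: "CARD('a) - 1 = 2 * m"
  using card by simp

lemma inj_f: "inj f"
proof (rule injI)
  fix x y assume "f x = f y"
  then show "x = y"
    using f[of x y] \<epsilon> m_pos by (simp add: power_0_left)
qed

lemma surj_f: "surj f"
  using inj_f by (simp add: finite_UNIV_inj_surj)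

text \<open>As a polynomial in \<open>z\<close>, the sum of \<open>x ^ t * (z - f x) ^ m\<close>
  over all \<open>x\<close> vanishes at each \<open>z = f y\<close>: the hypothesis on
  \<open>f\<close> turns it into the sum over \<open>x\<close> of a polynomial of degree at most
  \<open>t + m < q - 1\<close>. Having degree at most \<open>m\<close> and \<open>q\<close> roots,
  it is zero; its coefficient at \<open>m - k\<close> yields the claim.\<close>

lemma sum_power_times_power_eq_0:
  assumes "k \<le> m" "\<not> CHAR('a) dvd (m choose k)" "t < m"
  shows "(\<Sum>x\<in>UNIV. x ^ t * f x ^ k) = 0"
proof -
  let ?P = "\<Sum>x\<in>UNIV. smult (x ^ t) ([:- f x, 1:] ^ m)"
  have "poly ?P z = 0" for z
  proof -
    obtain y where y: "z = f y"
      using surj_f by blast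
    let ?R = "smult \<epsilon> (monom 1 t * [:y, - 1:] ^ m)"
    have "degree ?R \<le> t + m"
      by (intro order.trans[OF degree_smult_le] order.trans[OF degree_mult_le] add_mono
          order.trans[OF degree_power_le] degree_monom_le) auto
    then have deg: "degree ?R < CARD('a) - 1"
      using assms(3) card_minus_1 by simp
    have "poly ?P z = (\<Sum>x\<in>UNIV. x ^ t * (f y - f x) ^ m)"
      by (simp add: poly_sum poly_power y)
    \<comment> \<open>The inserted power has exponent 0; it exhibits the sum as minus the
      coefficient at \<open>q - 1\<close>, which lies beyond the degree.\<close>
    also have "\<dots> = (\<Sum>x\<in>UNIV. x ^ (CARD('a) - 1 - (CARD('a) - 1)) * poly ?R x)"
      by (simp add: f poly_power poly_monom mult_ac)
    also have "\<dots> = - poly.coeff ?R (CARD('a) - 1)"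
      using deg by (intro sum_power_times_poly) auto
    also have "\<dots> = 0"
      using deg by (simp only: coeff_eq_0) simp
    finally show ?thesis .
  qed
  moreover have "degree ?P \<le> m"
    by (intro degree_sum_le order.trans[OF degree_smult_le] order.trans[OF degree_power_le]) auto
  ultimately have "?P = 0"
    using card by (intro poly_eqI_degree[of UNIV]) auto
  then have "0 = poly.coeff ?P (m - k)"
    by simp
  also have "\<dots> = (\<Sum>x\<in>UNIV. x ^ t * (of_nat (m choose k) * (- f x) ^ k))"
    using assms(1) by (simp add: coeff_sum coeff_linear_poly_power binomial_symmetric[symmetric])
  also have "\<dots> = of_nat (m choose k) * (- 1) ^ k * (\<Sum>x\<in>UNIV. x ^ t * f x ^ k)"
    by (simp add: sum_distrib_left power_minus[of "f _"] mult_ac)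
  finally show ?thesis
    using assms(2) by (simp add: of_nat_eq_0_iff_char_dvd)
qed

text \<open>If the degree \<open>s\<close> exceeded \<open>m\<close>, the leading coefficient would
  be, up to sign, the sum of \<open>x ^ (q - 1 - s) * f x ^ k\<close>, which vanishes because
  \<open>q - 1 - s < m\<close>.\<close>

lemma degree_le_half:
  assumes "degree P \<le> CARD('a) - 1" "\<And>x. poly P x = f x ^ k"
    "k \<le> m" "\<not> CHAR('a) dvd (m choose k)"
  shows "degree P \<le> m"
proof (rule ccontr)
  assume deg: "\<not> ?thesis"
  let ?s = "degree P"
  have "- poly.coeff P ?s = (\<Sum>x\<in>UNIV. x ^ (CARD('a) - 1 - ?s) * poly P x)"
    using deg assms(1) by (intro sum_power_times_poly[symmetric]) auto
  also have "\<dots> = 0"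
    unfolding assms(2) using deg card assms by (intro sum_power_times_power_eq_0) auto
  finally show False
    using deg by simp
qed

text \<open>The reduced polynomial of the \<open>i\<close>-th Frobenius conjugate of
  \<open>f\<close>; \<open>frob_poly 0\<close> represents \<open>f\<close> itself.\<close>

definition frob_poly :: "nat \<Rightarrow> 'a poly" where
  "frob_poly i = (SOME P. degree P \<le> CARD('a) - 1 \<and> (\<forall>x. poly P x = f x ^ (CHAR('a) ^ i)))"

lemma
  degree_frob_poly_le: "degree (frob_poly i) \<le> CARD('a) - 1" and
  poly_frob_poly: "poly (frob_poly i) x = f x ^ (CHAR('a) ^ i)"
  using someI_ex[OF finite_field_interpolation[of "\<lambda>x. f x ^ (CHAR('a) ^ i)"]]
  unfolding frob_poly_def by blast+

lemma frob_poly_nonzero: "frob_poly i \<noteq> 0"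
proof
  assume "frob_poly i = 0"
  then have "f x = 0" for x
    using poly_frob_poly[of i x] by simp
  then show False
    using inj_f by (metis injD zero_neq_one)
qed

text \<open>Frobenius carries a term of exponent \<open>j\<close> to exponent
  \<open>p ^ i * j\<close> modulo \<open>q - 1\<close>. Unless this residue is 0, power sums
  identify the coefficient there, up to sign, with the \<open>p ^ i\<close>-th power of the one at
  \<open>j\<close>.\<close>

lemma degree_frob_poly_ge:
  assumes "poly.coeff (frob_poly 0) j \<noteq> 0" "j > 0"
  shows "CHAR('a) ^ i * j mod (CARD('a) - 1) \<le> degree (frob_poly i)"
proof (rule ccontr)
  let ?Q = "CARD('a) - 1"
  let ?s = "CHAR('a) ^ i * j mod ?Q"
  assume *: "\<not> ?thesis"
  have Q: "?Q > 0"
    using m_pos card by simp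
  have j: "j \<le> ?Q"
    using assms(1) degree_frob_poly_le[of 0] by (meson le_degree order.trans)
  have s: "0 < ?s" "?s < ?Q"
    using * Q by auto
  \<comment> \<open>This keeps \<open>(q - 1 - j) * p ^ i\<close> positive, as
    \<open>finite_field_power_cong\<close> requires.\<close>
  have "j \<noteq> ?Q"
    using s by (intro notI) simp
  have cong: "[?Q - ?s = (?Q - j) * CHAR('a) ^ i] (mod ?Q)"
  proof -
    have "(?Q - j) * CHAR('a) ^ i + CHAR('a) ^ i * j = ?Q * CHAR('a) ^ i"
      using j by (metis add_mult_distrib le_add_diff_inverse2 mult.commute)
    then have "[(?Q - ?s) + ?s = (?Q - j) * CHAR('a) ^ i + CHAR('a) ^ i * j] (mod ?Q)"
      using s by (simp add: cong_def)
    moreover have "[(?Q - j) * CHAR('a) ^ i + CHAR('a) ^ i * j = (?Q - j) * CHAR('a) ^ i + ?s] (mod ?Q)"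
      unfolding cong_def by (rule mod_add_right_eq[symmetric])
    ultimately have "[(?Q - ?s) + ?s = (?Q - j) * CHAR('a) ^ i + ?s] (mod ?Q)"
      by (rule cong_trans)
    then show ?thesis
      by (simp only: cong_add_rcancel_nat)
  qed
  have "0 = - poly.coeff (frob_poly i) ?s"
    using * by (simp add: coeff_eq_0)
  also have "\<dots> = (\<Sum>x\<in>UNIV. x ^ (?Q - ?s) * f x ^ (CHAR('a) ^ i))"
    using sum_power_times_poly[OF degree_frob_poly_le, of ?s i] s by (simp add: poly_frob_poly)
  also have "\<dots> = (\<Sum>x\<in>UNIV. x ^ ((?Q - j) * CHAR('a) ^ i) * f x ^ (CHAR('a) ^ i))"
  proof -
    have "?Q - ?s > 0"
      using s(2) by (simp only: zero_less_diff)
    moreover have "(?Q - j) * CHAR('a) ^ i > 0"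
      using j \<open>j \<noteq> ?Q\<close> by simp
    ultimately have "x ^ (?Q - ?s) = x ^ ((?Q - j) * CHAR('a) ^ i)" for x :: 'a
      using cong by (intro finite_field_power_cong)
    then show ?thesis
      by simp
  qed
  also have "\<dots> = (\<Sum>x\<in>UNIV. x ^ (?Q - j) * f x) ^ (CHAR('a) ^ i)"
    by (simp add: freshmans_dream_sum'[of _ i] power_mult_distrib power_mult)
  also have "\<dots> = (- poly.coeff (frob_poly 0) j) ^ (CHAR('a) ^ i)"
    using sum_power_times_poly[OF degree_frob_poly_le, of j 0] assms(2) j by (simp add: poly_frob_poly)
  finally show False
    using assms(1) by simp
qed

theorem quadratic_character_preserving_imp_monomial:
  "\<exists>a c k. \<forall>x. f x = a * x ^ (CHAR('a) ^ k) + c"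
proof -
  let ?p = "CHAR('a)"
  obtain e where e: "e > 0" "CARD('a) = ?p ^ e"
    using finite_field_card_prime_power by blast
  have p: "prime ?p" "?p > 1"
    using CHAR_prime[where 'a='a] prime_gt_1_nat by blast+
  have "odd ?p"
    using card e by (metis even_add even_mult_iff even_power odd_one even_numeral)
  then obtain h where h: "?p = 2 * h + 1"
    by (elim oddE)
  let ?N = "\<Sum>i<e. ?p ^ i"
  let ?d = "\<lambda>i. degree (frob_poly i)"
  have "(?p - 1) * ?N = ?p ^ e - 1"
    using p power_diff_1_eq_nat[of ?p e] by simp
  then have hN: "h * ?N = m"
    using h e card by simp
  \<comment> \<open>The product of the conjugates with multiplicities \<open>c i\<close> represents
    \<open>f ^ k\<close>, where \<open>k\<close> has digits \<open>c i\<close>. Degree at most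
    \<open>q - 1\<close> makes it reduced, and \<open>degree_le_half\<close> sharpens the bound to
    \<open>m\<close>.\<close>
  have bound: "(\<Sum>i<e. c i * ?d i) \<le> m"
    if c: "\<And>i. i < e \<Longrightarrow> c i \<le> h" and le: "(\<Sum>i<e. c i * ?d i) \<le> CARD('a) - 1" for c
  proof -
    let ?P = "\<Prod>i<e. frob_poly i ^ c i"
    let ?k = "\<Sum>i<e. c i * ?p ^ i"
    have deg: "degree ?P = (\<Sum>i<e. c i * ?d i)"
      by (subst degree_prod_eq_sum_degree) (auto simp: frob_poly_nonzero degree_power_eq)
    have "degree ?P \<le> m"
    proof (rule degree_le_half)
      show "poly ?P x = f x ^ ?k" for x
        by (simp add: poly_prod poly_power poly_frob_poly power_sum mult.commute flip: power_mult)
      have m: "m = (\<Sum>i<e. h * ?p ^ i)"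
        using hN by (simp add: sum_distrib_left)
      show "?k \<le> m"
        unfolding m using c by (intro sum_mono mult_right_mono) auto
      show "\<not> ?p dvd (m choose ?k)"
        unfolding m using p h c by (intro not_dvd_binomial_digits) auto
    qed (use deg le in auto)
    then show ?thesis
      using deg by simp
  qed
  have "h > 0"
    using p h by (cases h) auto
  have d_le: "?d i \<le> m" if "i < e" for i
  proof -
    have "(\<Sum>j<e. (if j = i then 1 else 0) * ?d j) = ?d i"
      using that by (simp add: if_distrib[of "\<lambda>x. x * _"] cong: if_cong)
    then show ?thesis
      using bound[of "\<lambda>j. if j = i then 1 else 0"] \<open>h > 0\<close> degree_frob_poly_le[of i] by auto
  qed
  \<comment> \<open>Lowering one digit leaves a degree sum of at most \<open>m\<close>, and
    restoring it adds at most \<open>m\<close>. The total stays within \<open>2 * m = q - 1\<close>,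
    where \<open>bound\<close> applies.\<close>
  have all: "(\<Sum>i<e. c i * ?d i) \<le> m" if "\<And>i. i < e \<Longrightarrow> c i \<le> h" for c
    using that
  proof (induction "\<Sum>i<e. c i" arbitrary: c)
    case 0
    then show ?case
      by simp
  next
    case (Suc n)
    then obtain i where i: "i < e" "c i > 0"
      by (metis lessThan_iff not_gr_zero sum.neutral nat.distinct(1))
    let ?c = "c(i := c i - 1)"
    have split: "(\<Sum>j<e. c j * g j) = (\<Sum>j<e. ?c j * g j) + g i" for g :: "nat \<Rightarrow> nat"
    proof -
      have "(\<Sum>j<e. c j * g j) = c i * g i + (\<Sum>j\<in>{..<e} - {i}. c j * g j)"
        using i by (intro sum.remove) auto
      moreover have "(\<Sum>j<e. ?c j * g j) = (c i - 1) * g i + (\<Sum>j\<in>{..<e} - {i}. c j * g j)"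
        using i by (subst sum.remove[of _ i]) auto
      moreover have "c i * g i = (c i - 1) * g i + g i"
        using i by (cases "c i") auto
      ultimately show ?thesis
        by simp
    qed
    have "(\<Sum>j<e. ?c j * ?d j) \<le> m"
    proof (rule Suc.hyps)
      show "n = sum ?c {..<e}"
        using split[of "\<lambda>_. 1"] Suc.hyps(2) by simp
      show "?c j \<le> h" if "j < e" for j
        using Suc.prems[OF that] Suc.prems[OF i(1)] by auto
    qed
    then have "(\<Sum>j<e. c j * ?d j) \<le> CARD('a) - 1"
      using split[of ?d] d_le[OF i(1)] card by simp
    then show ?case
      using Suc.prems by (intro bound) auto
  qed
  have sum_d: "(\<Sum>i<e. ?d i) \<le> ?N"
  proof -
    have "h * (\<Sum>i<e. ?d i) \<le> h * ?N"
      using all[of "\<lambda>_. h"] hN by (simp add: sum_distrib_left)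
    then show ?thesis
      using \<open>h > 0\<close> by simp
  qed
  let ?F = "frob_poly 0"
  let ?Q = "CARD('a) - 1"
  have F: "poly ?F x = f x" for x
    using poly_frob_poly[of 0] by simp
  have F_le: "?d 0 \<le> m"
    using e by (intro d_le)
  have not_dvd: "\<not> ?Q dvd j" if "poly.coeff ?F j \<noteq> 0" "j > 0" for j
  proof -
    have "j \<le> m"
      using that F_le le_degree order.trans by blast
    then show ?thesis
      using that card m_pos by (auto dest: dvd_imp_le)
  qed
  \<comment> \<open>A positive exponent below the degree would make the comparison of shifts with
    degrees strict at \<open>i = 0\<close>, pushing the shift sum below its minimum
    \<open>?N\<close>.\<close>
  have support: "j = ?d 0" if j: "poly.coeff ?F j \<noteq> 0" "j > 0" for j
  proof (rule ccontr)
    assume "j \<noteq> ?d 0"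
    then have "j < ?d 0"
      using j le_degree[of ?F j] by simp
    then have "?p ^ 0 * j mod ?Q < ?d 0"
      by (metis mod_less_eq_dividend mult_1 order_le_less_trans power_0)
    moreover have "?p ^ i * j mod ?Q \<le> ?d i" for i
      using j by (rule degree_frob_poly_ge)
    ultimately have "(\<Sum>i<e. ?p ^ i * j mod ?Q) < (\<Sum>i<e. ?d i)"
      using e(1) by (intro sum_strict_mono_ex1 bexI[of _ 0]) auto
    moreover have "?N \<le> (\<Sum>i<e. ?p ^ i * j mod ?Q)"
      using sum_cyclic_shifts_ge[OF p(2) e(1), of j] not_dvd[OF j] by (simp add: cyclic_shift_def flip: e(2))
    ultimately show False
      using sum_d by simp
  qed
  have d0: "?d 0 > 0"
  proof (rule ccontr)
    assume "\<not> ?thesis"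
    then obtain b where "?F = [:b:]"
      by (auto elim: degree_eq_zeroE)
    then have "f 0 = f 1"
      using F[of 0] F[of 1] by simp
    then show False
      using inj_f by (metis injD zero_neq_one)
  qed
  have lead: "poly.coeff ?F (?d 0) \<noteq> 0"
    using frob_poly_nonzero by simp
  have "(\<Sum>i<e. ?p ^ i * ?d 0 mod ?Q) \<le> ?N"
    using sum_mono[of "{..<e}" "\<lambda>i. ?p ^ i * ?d 0 mod ?Q" ?d] degree_frob_poly_ge[OF lead d0] sum_d
    by fastforce
  then obtain I where I: "?p ^ I * ?d 0 mod ?Q = 1"
    using cyclic_shift_eq_1[OF p(2) e(1), of "?d 0"] not_dvd[OF lead d0]
    by (auto simp: cyclic_shift_def simp flip: e(2))
  \<comment> \<open>The factor \<open>p ^ (I * (e - 1))\<close> completes \<open>p ^ I\<close> to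
    \<open>q ^ I\<close>, an exponent that fixes every field element, so it undoes the shift by
    \<open>I\<close>.\<close>
  have pow: "x ^ ?d 0 = x ^ (?p ^ (I * (e - 1)))" for x :: 'a
  proof -
    have Q: "?Q > 1"
      using card m_pos by simp
    have "I + I * (e - 1) = e * I"
      using e by (cases e) auto
    then have "?p ^ I * ?p ^ (I * (e - 1)) = CARD('a) ^ I"
      by (metis e(2) power_add power_mult)
    then have "x ^ ?d 0 = (x ^ ?d 0) ^ (?p ^ I * ?p ^ (I * (e - 1)))"
      by (simp add: finite_field_power_card_power_eq_same)
    also have "\<dots> = (x ^ (?p ^ I * ?d 0)) ^ (?p ^ (I * (e - 1)))"
      by (metis mult.commute power_mult)
    also have "x ^ (?p ^ I * ?d 0) = x ^ 1"
      using I Q d0 p by (intro finite_field_power_cong) (auto simp: cong_def)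
    finally show ?thesis
      by simp
  qed
  have "f x = poly.coeff ?F (?d 0) * x ^ (?p ^ (I * (e - 1))) + poly.coeff ?F 0" for x
  proof -
    have "f x = (\<Sum>j\<le>?d 0. poly.coeff ?F j * x ^ j)"
      using F[of x] by (simp add: poly_altdef)
    also have "\<dots> = (\<Sum>j\<in>{?d 0, 0}. poly.coeff ?F j * x ^ j)"
      using support by (intro sum.mono_neutral_right) auto
    also have "\<dots> = poly.coeff ?F (?d 0) * x ^ ?d 0 + poly.coeff ?F 0"
      using d0 by simp
    finally show ?thesis
      by (simp add: pow)
  qed
  then show ?thesis
    by blast
qed

end

subsection \<open>Lines of \<open>PG(3,q)\<close>\<close>

lemma points_in_image:
  fixes A B :: "'a::field ^ 4 \<Rightarrow> 'a ^ 4"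
  assumes A: "Vector_Spaces.linear (*s) (*s) A" and B: "Vector_Spaces.linear (*s) (*s) B"
    and BA: "\<And>v. B (A v) = v" and AB: "\<And>v. A (B v) = v"
  shows "(`) A ` points_in W = points_in (A ` W)"
proof -
  \<comment> \<open>Stated for arbitrary maps because the converse inclusion applies it to
    \<open>B\<close>.\<close>
  have sub: "(`) A ` points_in W \<subseteq> points_in (A ` W)"
    if A: "Vector_Spaces.linear (*s) (*s) A" and BA: "\<And>v. B (A v) = v"
    for A B :: "'a ^ 4 \<Rightarrow> 'a ^ 4" and W
  proof -
    interpret A: Vector_Spaces.linear "(*s)" "(*s)" A
      by (rule A)
    have "inj A"
      by (metis BA injI)
    then have "vec.dim (A ` P) = vec.dim P" for P
      using A by (intro vec.dim_image_eq) (auto intro: inj_on_subset)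
    then show ?thesis
      by (auto simp: points_in_def pg_points_def A.subspace_image)
  qed
  have "P \<in> (`) A ` points_in W" if P: "P \<in> points_in (A ` W)" for P
  proof -
    have "B ` P \<in> points_in (B ` A ` W)"
      using sub[OF B AB, of "A ` W"] P by blast
    moreover have "B ` A ` W = W" "A ` B ` P = P"
      by (simp_all add: image_image BA AB)
    ultimately show ?thesis
      by (metis imageI)
  qed
  with sub[OF A BA] show ?thesis
    by blast
qed

lemma pg_points_conv_points_in: "pg_points = points_in UNIV"
  by (simp add: points_in_def)

lemma pg_collineation_image:
  fixes A B :: "'a::field ^ 4 \<Rightarrow> 'a ^ 4"
  assumes A: "Vector_Spaces.linear (*s) (*s) A" and B: "Vector_Spaces.linear (*s) (*s) B"
    and BA: "\<And>v. B (A v) = v" and AB: "\<And>v. A (B v) = v"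
  shows "pg_collineation ((`) A)"
proof -
  have surj: "surj A" and inj: "inj A"
    using AB BA by (metis surjI, metis injI)
  have lines: "(`) A ` l \<in> pg_lines" if l: "l \<in> pg_lines"
    and A: "Vector_Spaces.linear (*s) (*s) A" and B: "Vector_Spaces.linear (*s) (*s) B"
    and BA: "\<And>v. B (A v) = v" and AB: "\<And>v. A (B v) = v"
    for A B :: "'a ^ 4 \<Rightarrow> 'a ^ 4" and l
  proof -
    interpret A: Vector_Spaces.linear "(*s)" "(*s)" A
      by (rule A)
    obtain W where W: "vec.subspace W" "vec.dim W = 2" "l = points_in W"
      using l by (auto simp: pg_lines_def)
    have "inj A"
      by (metis BA injI)
    then have "vec.dim (A ` W) = 2"
      using A W(2) by (subst vec.dim_image_eq) (auto intro: inj_on_subset)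
    moreover have "vec.subspace (A ` W)"
      using W(1) by (rule A.subspace_image)
    ultimately show ?thesis
      using points_in_image[OF A B BA AB, of W] W(3) unfolding pg_lines_def by blast
  qed
  have "bij_betw ((`) A) pg_points pg_points"
  proof (rule bij_betw_imageI)
    show "inj_on ((`) A) pg_points"
      using inj by (auto intro!: inj_onI simp: inj_image_eq_iff)
    show "(`) A ` pg_points = pg_points"
      using points_in_image[OF A B BA AB, of UNIV] surj by (simp add: pg_points_conv_points_in)
  qed
  moreover have "l \<in> pg_lines" if "(`) A ` l \<in> pg_lines" for l
    using lines[OF that B A AB BA] by (simp add: image_image BA)
  ultimately show ?thesis
    using lines[OF _ A B BA AB] unfolding pg_collineation_def by blast
qed

lemma image_line_through:
  fixes A B :: "'a::field ^ 4 \<Rightarrow> 'a ^ 4"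
  assumes A: "Vector_Spaces.linear (*s) (*s) A" and B: "Vector_Spaces.linear (*s) (*s) B"
    and BA: "\<And>v. B (A v) = v" and AB: "\<And>v. A (B v) = v"
  shows "(`) A ` line_through u v = line_through (A u) (A v)"
proof -
  interpret A: Vector_Spaces.linear "(*s)" "(*s)" A
    by (rule A)
  have "A ` vec.span {u, v} = vec.span {A u, A v}"
    using A.span_image[of "{u, v}"] by simp
  then show ?thesis
    unfolding line_through_def by (simp add: points_in_image[OF assms])
qed

text \<open>The shear adding \<open>c * x_0\<close> to \<open>x_3\<close> fixes all vectors with
  \<open>x_0 = 0\<close>, so it changes only the last entry of the generators that start with
  1.\<close>

lemma S_lines_add_const:
  fixes g :: "'a::field \<Rightarrow> 'a \<Rightarrow> 'a"
  shows "\<exists>f. pg_collineation f \<and> (\<lambda>l. f ` l) ` S_lines g = S_lines (\<lambda>x y. g x y + c)"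
proof -
  define A where "A c v = (\<chi> i. if i = 4 then v $ 4 + c * v $ 1 else v $ i)" for c :: 'a and v :: "'a ^ 4"
  have lin: "Vector_Spaces.linear (*s) (*s) (A c)" for c
    unfolding Vector_Spaces.linear_iff using vec.vector_space_axioms by (simp add: A_def vec_eq_iff distrib_left mult.left_commute)
  have inv: "A (- c) (A c v) = v" "A c (A (- c) v) = v" for v
    by (auto simp: A_def vec_eq_iff)
  have A_vector: "A c (vector [0, x, y, z]) = vector [0, x, y, z]"
    "A c (vector [1, x, y, z]) = vector [1, x, y, z + c]" for x y z
    by (simp_all add: A_def vec_eq_iff forall_4)
  have S_lines: "S_lines g = insert (line_through (vector [0, 0, 0, 1]) (vector [0, 0, 1, 0]))
      (range (\<lambda>(x, y). line_through (vector [0, 1, x, y]) (vector [1, 0, - y, g x y])))"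
    for g :: "'a \<Rightarrow> 'a \<Rightarrow> 'a"
    by (auto simp: S_lines_def)
  have "(\<lambda>l. (`) (A c) ` l) ` S_lines g = S_lines (\<lambda>x y. g x y + c)"
    by (simp only: S_lines image_insert image_image case_prod_unfold image_line_through[OF lin lin inv] A_vector)
  moreover have "pg_collineation ((`) (A c))"
    by (rule pg_collineation_image[OF lin lin inv])
  ultimately show ?thesis
    by blast
qed

section \<open>Skewness of the spread lines\<close>

lemma span_pair_iff:
  fixes u v :: "'a::field ^ 'n"
  shows "w \<in> vec.span {u, v} \<longleftrightarrow> (\<exists>a b. w = a *s u + b *s v)"
proof
  assume "w \<in> vec.span {u, v}"
  then show "\<exists>a b. w = a *s u + b *s v"
    by (auto simp: vec.span_insert vec.span_singleton algebra_simps)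
next
  assume "\<exists>a b. w = a *s u + b *s v"
  then show "w \<in> vec.span {u, v}"
    by (elim exE ssubst) (intro vec.span_add vec.span_scale vec.span_base, simp_all)
qed

lemma span_singleton_in_points_in:
  fixes w :: "'a::field ^ 4"
  assumes "w \<noteq> 0" "w \<in> W" "vec.subspace W"
  shows "vec.span {w} \<in> points_in W"
proof -
  have "vec.dim (vec.span {w}) = 1"
    using assms(1) vec.dim_eq_card_independent[of "{w}"] by (simp add: vec.dim_span)
  moreover have "vec.span {w} \<subseteq> W"
    using assms by (intro vec.span_minimal) auto
  ultimately show ?thesis
    by (simp add: points_in_def pg_points_def)
qed

lemma line_through_meet_imp_eq:
  assumes "pg_spread S" "line_through u v \<in> S" "line_through u' v' \<in> S" "w \<noteq> 0"
    "w \<in> vec.span {u, v}" "w \<in> vec.span {u', v'}"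
  shows "line_through u v = line_through u' v'"
proof -
  have "vec.span {w} \<in> line_through u v \<inter> line_through u' v'"
    using assms(4-6) by (auto simp: line_through_def intro!: span_singleton_in_points_in)
  moreover have "disjoint S"
    using assms(1) by (simp add: pg_spread_def partition_on_def)
  ultimately show ?thesis
    using disjointD[of S, OF _ assms(2,3)] by (metis empty_iff)
qed

text \<open>Up to sign, this is the determinant of the four vectors spanning the two lines.\<close>

lemma pg_spread_S_lines_det_nonzero:
  fixes g :: "'a::field \<Rightarrow> 'a \<Rightarrow> 'a"
  assumes "pg_spread (S_lines g)" "x \<noteq> x'"
  shows "(x - x') * (g x y - g x' y') + (y - y')\<^sup>2 \<noteq> 0"
proof
  assume det: "(x - x') * (g x y - g x' y') + (y - y')\<^sup>2 = 0"
  let ?u = "\<lambda>x y. vector [0, 1, x, y] :: 'a ^ 4"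
  let ?v = "\<lambda>x y. vector [1, 0, - y, g x y] :: 'a ^ 4"
  \<comment> \<open>The first two coordinates force equal coefficients on both lines, and the third
    fixes their ratio; \<open>det\<close> supplies the fourth.\<close>
  define w where "w = (y - y') *s ?u x y + (x - x') *s ?v x y"
  have w': "w = (y - y') *s ?u x' y' + (x - x') *s ?v x' y'"
    using det unfolding w_def vec_eq_iff forall_4 by (simp add: power2_eq_square) algebra
  have "w $ 1 = x - x'"
    by (simp add: w_def)
  then have "w \<noteq> 0"
    using assms(2) by auto
  moreover have "line_through (?u x y) (?v x y) \<in> S_lines g" for x y
    by (auto simp: S_lines_def)
  moreover have "w \<in> vec.span {?u x y, ?v x y}" "w \<in> vec.span {?u x' y', ?v x' y'}"
    unfolding span_pair_iff by (intro exI, rule w_def) (intro exI, rule w')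
  ultimately have "line_through (?u x y) (?v x y) = line_through (?u x' y') (?v x' y')"
    by (intro line_through_meet_imp_eq[OF assms(1)])
  moreover have "?u x y \<noteq> 0"
    by (auto simp: vec_eq_iff forall_4)
  then have "vec.span {?u x y} \<in> line_through (?u x y) (?v x y)"
    unfolding line_through_def by (intro span_singleton_in_points_in) (auto intro: vec.span_base)
  \<comment> \<open>If the lines coincide, the first two coordinates of \<open>?u x y\<close> force
    \<open>b = 0\<close> and \<open>a = 1\<close>, and the third then gives
    \<open>x = x'\<close>.\<close>
  ultimately have "vec.span {?u x y} \<subseteq> vec.span {?u x' y', ?v x' y'}"
    by (simp add: line_through_def points_in_def)
  then have "?u x y \<in> vec.span {?u x' y', ?v x' y'}"
    using vec.span_base by blast
  then obtain a b where "?u x y = a *s ?u x' y' + b *s ?v x' y'"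
    unfolding span_pair_iff by blast
  then show False
    using assms(2) by (auto simp: vec_eq_iff forall_4)
qed

section \<open>From the spread condition through Carlitz's theorem to a Kantor spread\<close>

theorem theorem5:
  fixes h\<^sub>1 :: "'a::finite_field poly" and g :: "'a \<Rightarrow> 'a \<Rightarrow> 'a"
  assumes "odd CARD('a)"
    and "\<And>x y. g x y = poly h\<^sub>1 x"
    and "pg_spread (S_lines g)"
  shows "regular_spread (S_lines g) \<or> kantor_spread (S_lines g)"
proof -
  let ?h = "poly h\<^sub>1"
  \<comment> \<open>If this were \<open>s ^ 2\<close>, the lines with parameters
    \<open>(x, s)\<close> and \<open>(x', 0)\<close> would have determinant 0.\<close>
  have nonsquare: "\<not> is_square (- ((x - x') * (?h x - ?h x')))" if "x \<noteq> x'" for x x'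
  proof
    assume "is_square (- ((x - x') * (?h x - ?h x')))"
    then obtain s where "- ((x - x') * (?h x - ?h x')) = s\<^sup>2"
      by (elim is_nth_powerE)
    then have "(x - x') * (g x s - g x' 0) + (s - 0)\<^sup>2 = 0"
      by (simp add: assms(2) neg_eq_iff_add_eq_0)
    then show False
      using pg_spread_S_lines_det_nonzero[OF assms(3) that] by blast
  qed
  define m where "m = (CARD('a) - 1) div 2"
  have m: "CARD('a) = 2 * m + 1"
    using assms(1) by (auto simp: m_def elim!: oddE)
  have "m > 0"
    using m finite_field_card_gt_1[where 'a='a] by simp
  \<comment> \<open>Euler's criterion gives -1 for the \<open>m\<close>-th power of the non-square
    product. Its factors \<open>(- 1) ^ m\<close> and \<open>(x - x') ^ m\<close> square to 1, so
    multiplying by them isolates the remaining factor.\<close>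
  have diff: "(?h x - ?h x') ^ m = - ((- 1) ^ m) * (x - x') ^ m" for x x'
  proof (cases "x = x'")
    case False
    have sq: "((x - x') ^ m)\<^sup>2 = 1"
      using finite_field_power_card_minus_1[of "x - x'"] False m
      by (simp add: mult.commute flip: power_mult)
    have sq': "((- 1) ^ m)\<^sup>2 = (1 :: 'a)"
      by (simp flip: power_mult add: mult.commute)
    have "(- 1) ^ m * (x - x') ^ m * (?h x - ?h x') ^ m = (- ((x - x') * (?h x - ?h x'))) ^ m"
      by (simp only: power_minus[of "_ * _"] power_mult_distrib mult.assoc)
    also have "\<dots> = - 1"
      unfolding m_def using assms(1) nonsquare[OF False] by (rule not_square_power_half_card)
    finally have prod: "(- 1) ^ m * (x - x') ^ m * (?h x - ?h x') ^ m = - 1" .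
    have "(?h x - ?h x') ^ m = ((- 1) ^ m)\<^sup>2 * ((x - x') ^ m)\<^sup>2 * (?h x - ?h x') ^ m"
      by (simp only: sq sq' mult_1_left)
    also have "\<dots> = (- 1) ^ m * (x - x') ^ m * ((- 1) ^ m * (x - x') ^ m * (?h x - ?h x') ^ m)"
      by (simp only: power2_eq_square mult_ac)
    finally show ?thesis
      unfolding prod by simp
  qed (use \<open>m > 0\<close> in \<open>simp add: power_0_left\<close>)
  obtain a c k where h: "\<And>x. ?h x = a * x ^ (CHAR('a) ^ k) + c"
    using quadratic_character_preserving_imp_monomial[OF m _ diff] by auto
  \<comment> \<open>The pair 1, 0 gives \<open>?h 1 - ?h 0 = a\<close>; the Kantor parameter is
    \<open>n = - a\<close>.\<close>
  have "\<not> is_square (- a)"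
    using nonsquare[of 1 0] by (simp add: h power_0_left)
  moreover obtain f where "pg_collineation f"
    "(\<lambda>l. f ` l) ` S_lines (\<lambda>x y. - (- a) * x ^ (CHAR('a) ^ k)) =
       S_lines (\<lambda>x y. - (- a) * x ^ (CHAR('a) ^ k) + c)"
    using S_lines_add_const[where g = "\<lambda>x y. - (- a) * x ^ (CHAR('a) ^ k)" and c = c] by (elim exE conjE)
  moreover have "g = (\<lambda>x y. - (- a) * x ^ (CHAR('a) ^ k) + c)"
    by (simp add: fun_eq_iff assms(2) h)
  ultimately have "kantor_spread (S_lines g)"
    unfolding kantor_spread_def using assms(3) by (intro conjI exI[of _ f] exI[of _ "- a"] exI[of _ k]) simp_all
  then show ?thesis
    by blast
qed

end
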